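(* Let $W$ be the communication matrix of a strongly connected network of $n$ agents, and for $\alpha\in[0,1]$ let $W'=\alpha W+(1-\alpha)I_n$ be the modified communication matrix. When $\lambda_n(W)+\lambda_2(W)<0$, the optimal spectral gap of $W'$ (that is, the maximum of $\gamma(W')=1-\lambda_{\max}(W')$ over $\alpha\in[0,1]$) is $$\gamma^*=\frac{2-2\lambda_2(W)}{2-\lambda_n(W)-\lambda_2(W)}\qquad\text{for}\qquad \alpha^*=\frac{2}{2-\lambda_n(W)-\lambda_2(W)} .$$
   Context: A network of $n$ agents is described by a directed graph on $\{1,\dots,n\}$ with edge set $E$, where agent $i$ receives information from agent $j$ only if $(i,j)\in E$. The communication matrix $W$ is an $n\times n$ row-stochastic matrix with nonnegative entries: $[W]_{ii}\ge 0$ is the self-reliance of agent $i$, and $[W]_{ij}>0$ is the weight agent $i$ assigns to information received from a neighbor $j$, with $[W]_{ij}>0$ only if $(i,j)\in E$. The network is assumed strongly connected (there is a directed path from any agent to any other agent), and $W$ is assumed diagonalizable. $I_n$ is the $n\times n$ identity matrix. For a matrix $M$, $\lambda_i(M)$ denotes its $i$-th largest eigenvalue, $\lambda_{\max}(M)=\max\{|\lambda_n(M)|,|\lambda_2(M)|\}$, and the spectral gap is $\gamma(M)=1-\lambda_{\max}(M)$. *)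

theory Defs
  imports
    "Graph_Theory.Graph_Theory"
    "Jordan_Normal_Form.Char_Poly"
begin

text \<open>Agents are numbered from 0, in accordance with matrix indices; an arc \<open>(i, j)\<close> means that agent
  \<open>i\<close> can receive information from agent \<open>j\<close>.\<close>

definition network :: "nat \<Rightarrow> nat pair_pre_digraph \<Rightarrow> bool" where
  "network n G \<longleftrightarrow> pair_wf_digraph G \<and> pverts G = {0..<n}"

definition row_stochastic :: "nat \<Rightarrow> real mat \<Rightarrow> bool" where
  "row_stochastic n W \<longleftrightarrow> W \<in> carrier_mat n n \<and>
     (\<forall>i<n. \<forall>j<n. 0 \<le> W $$ (i, j)) \<and> (\<forall>i<n. (\<Sum>j<n. W $$ (i, j)) = 1)"

text \<open>Self-reliance \<open>W $$ (i, i)\<close> does not require a loop in the graph. An arc may carry weight 0;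
  matrices whose off-diagonal support is exactly the arc set are included.\<close>

definition communication_matrix :: "nat \<Rightarrow> nat pair_pre_digraph \<Rightarrow> real mat \<Rightarrow> bool" where
  "communication_matrix n G W \<longleftrightarrow> row_stochastic n W \<and>
     (\<forall>i<n. \<forall>j<n. i \<noteq> j \<and> W $$ (i, j) > 0 \<longrightarrow> (i, j) \<in> parcs G)"

text \<open>Diagonalizability is over the given ring: for a real matrix it includes that all
  eigenvalues are real, without which they could not be ordered.\<close>

definition diagonalizable :: "'a :: comm_ring_1 mat \<Rightarrow> bool" where
  "diagonalizable A \<longleftrightarrow> (\<exists>D. diagonal_mat D \<and> similar_mat A D)"

text \<open>\<open>eig i M\<close> is the \<open>i\<close>-th largest real eigenvalue, for \<open>i\<close> counted from 1 and eigenvalues repeated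
  according to algebraic multiplicity. It is meaningful only while \<open>i\<close> does not exceed the
  number of real eigenvalues; for a diagonalizable real matrix this is the dimension.\<close>

definition eig :: "nat \<Rightarrow> real mat \<Rightarrow> real" where
  "eig i M = rev (sorted_list_of_multiset (proots (char_poly M))) ! (i - 1)"

definition eig_max :: "real mat \<Rightarrow> real" where
  "eig_max M = max \<bar>eig (dim_row M) M\<bar> \<bar>eig 2 M\<bar>"

definition spectral_gap :: "real mat \<Rightarrow> real" where
  "spectral_gap M = 1 - eig_max M"

definition modified_matrix :: "real \<Rightarrow> real mat \<Rightarrow> real mat" where
  "modified_matrix \<alpha> W = \<alpha> \<cdot>\<^sub>m W + (1 - \<alpha>) \<cdot>\<^sub>m 1\<^sub>m (dim_row W)"

end

theory Submission
  imports Defs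
begin

text \<open>An affine map applied to a diagonalizable matrix acts on its eigenvalues, so that
  \<open>eig i W' = 1 - \<alpha> * (1 - eig i W)\<close>. Hence the second-largest modulus is the maximum of the
  decreasing function \<open>1 - \<alpha> * (1 - eig 2 W)\<close> and the increasing function
  \<open>\<alpha> * (1 - eig n W) - 1\<close>, and the optimum is where the two lines meet. The first is
  decreasing since \<open>eig n W \<ge> -1\<close> by row-stochasticity, so that \<open>eig 2 W < - eig n W \<le> 1\<close>.\<close>

lemma proots_prod_list_linear_factors:
  fixes xs :: "'a :: idom list"
  shows "proots (\<Prod>a\<leftarrow>xs. [:- a, 1:]) = mset xs"
proof (induction xs)
  case (Cons a xs)
  \<comment> \<open>\<open>proots\<close> turns a product into a sum of multisets only when the
    product is nonzero.\<close>
  have "(\<Prod>a\<leftarrow>xs. [:- a, 1:]) \<noteq> 0"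
    by (auto simp: prod_list_zero_iff)
  with Cons show ?case
    by (simp add: proots_mult del: mult_pCons_left)
qed simp

lemma char_poly_similar_diagonal:
  assumes "similar_mat A D" and "diagonal_mat D"
  shows "char_poly A = (\<Prod>a\<leftarrow>diag_mat D. [:- a, 1:])"
proof -
  obtain n where D: "D \<in> carrier_mat n n"
    using similar_matD[OF assms(1)] by blast
  then have "upper_triangular D"
    using assms(2) unfolding diagonal_mat_def upper_triangular_def by auto
  then show ?thesis
    using char_poly_similar[OF assms(1)] char_poly_upper_triangular[OF D] by simp
qed

text \<open>Similar matrices share their characteristic polynomial, and that of \<open>D\<close> has
  the diagonal entries as its roots with multiplicity. From here on, \<open>eig\<close> is handled
  as an entry of a sorted list.\<close>

lemma eig_similar_diagonal:
  assumes "similar_mat A D" and "diagonal_mat D"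
  shows "eig i A = rev (sort (diag_mat D)) ! (i - 1)"
  unfolding eig_def char_poly_similar_diagonal[OF assms] proots_prod_list_linear_factors by simp

lemma dim_similar_mat:
  assumes "similar_mat A B"
  shows "dim_row A = dim_row B" "dim_col A = dim_row B" "dim_col B = dim_row B"
  using similar_matD[OF assms] by auto

text \<open>Conjugation is linear and fixes the identity, so the pair \<open>P\<close>,
  \<open>Q\<close> that relates \<open>A\<close> to \<open>B\<close> also relates the modified
  matrices.\<close>

lemma similar_mat_modified_matrix:
  assumes "similar_mat A B"
  shows "similar_mat (modified_matrix \<alpha> A) (modified_matrix \<alpha> B)"
proof -
  obtain n P Q where c: "{A, B, P, Q} \<subseteq> carrier_mat n n" and PQ: "P * Q = 1\<^sub>m n" "Q * P = 1\<^sub>m n"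
    and A: "A = P * B * Q"
    using similar_matD[OF assms] by blast
  have "modified_matrix \<alpha> A = P * modified_matrix \<alpha> B * Q"
  proof -
    have dims: "A \<in> carrier_mat n n" "B \<in> carrier_mat n n" "P \<in> carrier_mat n n" "Q \<in> carrier_mat n n"
      using c by auto
    then have dim_B: "dim_row B = n"
      by auto
    have "P * modified_matrix \<alpha> B * Q = (P * (\<alpha> \<cdot>\<^sub>m B) + P * ((1 - \<alpha>) \<cdot>\<^sub>m 1\<^sub>m n)) * Q"
      unfolding modified_matrix_def dim_B
      by (subst mult_add_distrib_mat[of _ n n]) (use dims in auto)
    also have "\<dots> = P * (\<alpha> \<cdot>\<^sub>m B) * Q + P * ((1 - \<alpha>) \<cdot>\<^sub>m 1\<^sub>m n) * Q"
      by (rule add_mult_distrib_mat[of _ n n]) (use c in auto)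
    also have "P * (\<alpha> \<cdot>\<^sub>m B) * Q = \<alpha> \<cdot>\<^sub>m A"
      using dims by (simp add: A mult_smult_distrib[of _ n n _ n] mult_smult_assoc_mat[of _ n n _ n])
    also have "P * ((1 - \<alpha>) \<cdot>\<^sub>m 1\<^sub>m n) * Q = (1 - \<alpha>) \<cdot>\<^sub>m 1\<^sub>m n"
      using dims PQ by (simp add: mult_smult_distrib[of _ n n _ n] mult_smult_assoc_mat[of _ n n _ n])
    finally show ?thesis
      using dims by (simp add: modified_matrix_def)
  qed
  then show ?thesis
    using c PQ by (intro similar_matI[of _ _ P Q n]) (auto simp: modified_matrix_def)
qed

lemma diagonal_mat_modified_matrix:
  assumes "diagonal_mat D" and "dim_col D = dim_row D"
  shows "diagonal_mat (modified_matrix \<alpha> D)"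
    and "diag_mat (modified_matrix \<alpha> D) = map (\<lambda>x. \<alpha> * x + (1 - \<alpha>)) (diag_mat D)"
  using assms by (auto simp: diagonal_mat_def modified_matrix_def diag_mat_def)

lemma sort_map_mono:
  fixes f :: "'a :: linorder \<Rightarrow> 'b :: linorder"
  assumes "mono f"
  shows "sort (map f xs) = map f (sort xs)"
proof (rule properties_for_sort)
  show "sorted (map f (sort xs))"
    unfolding sorted_map by (rule sorted_wrt_mono_rel[of _ "(\<le>)"]) (auto intro: monoD[OF assms])
qed simp

text \<open>Since \<alpha> \<ge> 0, the affine map preserves the order of the diagonal entries, so
  the \<open>i\<close>-th largest stays the \<open>i\<close>-th largest; a negative \<alpha> would
  reverse the order.\<close>

lemma eig_modified_matrix:
  assumes "diagonalizable W" and "1 \<le> i" and "i \<le> dim_row W" and "0 \<le> \<alpha>"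
  shows "eig i (modified_matrix \<alpha> W) = 1 - \<alpha> * (1 - eig i W)"
proof -
  obtain D where D: "diagonal_mat D" and sim: "similar_mat W D"
    using assms(1) unfolding diagonalizable_def by blast
  note dim = dim_similar_mat[OF sim]
  have "mono (\<lambda>x. \<alpha> * x + (1 - \<alpha>))"
    using assms(4) by (auto simp: mono_def mult_left_mono)
  then have "eig i (modified_matrix \<alpha> W) =
      rev (map (\<lambda>x. \<alpha> * x + (1 - \<alpha>)) (sort (diag_mat D))) ! (i - 1)"
    by (simp add: eig_similar_diagonal[OF similar_mat_modified_matrix[OF sim]]
        diagonal_mat_modified_matrix[OF D dim(3)] sort_map_mono)
  \<comment> \<open>The bounds on \<open>i\<close> put \<open>i - 1\<close> inside the list, where
    indexing commutes with \<open>map\<close>.\<close>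
  also have "\<dots> = \<alpha> * (rev (sort (diag_mat D)) ! (i - 1)) + (1 - \<alpha>)"
    using assms(2,3) dim by (simp add: rev_map diag_mat_def)
  finally show ?thesis
    by (simp add: eig_similar_diagonal[OF sim D] algebra_simps)
qed

text \<open>This lets the bound on eigenvalues of stochastic matrices apply to
  \<open>eig\<close>.\<close>

lemma eig_is_eigenvalue:
  assumes "diagonalizable W" and "1 \<le> i" and "i \<le> dim_row W"
  shows "eigenvalue W (eig i W)"
proof -
  obtain D where D: "diagonal_mat D" and sim: "similar_mat W D"
    using assms(1) unfolding diagonalizable_def by blast
  note dim = dim_similar_mat[OF sim]
  have "eig i W \<in> set (rev (sort (diag_mat D)))"
    unfolding eig_similar_diagonal[OF sim D]
    using assms(2,3) dim by (intro nth_mem) (simp add: diag_mat_def)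
  then have "eig i W \<in> set (diag_mat D)"
    by simp
  then have "poly (char_poly W) (eig i W) = 0"
    unfolding char_poly_similar_diagonal[OF sim D] poly_prod_list prod_list_zero_iff by force
  then show ?thesis
    using eigenvalue_root_char_poly[of W "dim_row W"] dim by auto
qed

text \<open>At a coordinate where an eigenvector has its largest modulus \<open>m\<close>, the
  corresponding row of \<open>W\<close> forms a weighted average of entries of modulus at most
  \<open>m\<close>. Hence \<open>\<bar>k\<bar> * m \<le> m\<close>, and \<open>m\<close> can be
  cancelled because the eigenvector is nonzero.\<close>

lemma row_stochastic_eigenvalue_bound:
  assumes "row_stochastic n W" and "eigenvalue W k"
  shows "\<bar>k\<bar> \<le> 1"
proof -
  have W: "W \<in> carrier_mat n n" and nonneg: "\<And>i j. i < n \<Longrightarrow> j < n \<Longrightarrow> 0 \<le> W $$ (i, j)"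
    and sum: "\<And>i. i < n \<Longrightarrow> (\<Sum>j<n. W $$ (i, j)) = 1"
    using assms(1) unfolding row_stochastic_def by auto
  obtain v where v: "v \<in> carrier_vec n" "v \<noteq> 0\<^sub>v n" "W *\<^sub>v v = k \<cdot>\<^sub>v v"
    using assms(2) W unfolding eigenvalue_def eigenvector_def by auto
  obtain l where l: "l < n" "v $ l \<noteq> 0"
    using v(1,2) by (metis carrier_vecD eq_vecI index_zero_vec)
  define m where "m = Max ((\<lambda>i. \<bar>v $ i\<bar>) ` {..<n})"
  have le_m: "\<bar>v $ j\<bar> \<le> m" if "j < n" for j
    unfolding m_def using that by (intro Max_ge) auto
  have "m \<in> (\<lambda>i. \<bar>v $ i\<bar>) ` {..<n}"
    unfolding m_def using l(1) by (intro Max_in) auto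
  then obtain i where i: "i < n" "m = \<bar>v $ i\<bar>"
    by auto
  have "k * v $ i = (W *\<^sub>v v) $ i"
    using v i(1) by simp
  also have "\<dots> = (\<Sum>j<n. W $$ (i, j) * v $ j)"
    using W v(1) i(1) by (simp add: scalar_prod_def atLeast0LessThan)
  finally have "\<bar>k\<bar> * m = \<bar>\<Sum>j<n. W $$ (i, j) * v $ j\<bar>"
    using i(2) by (simp flip: abs_mult)
  also have "\<dots> \<le> (\<Sum>j<n. W $$ (i, j) * m)"
    using nonneg[OF i(1)] le_m
    by (intro order.trans[OF sum_abs] sum_mono) (auto simp: abs_mult intro: mult_left_mono)
  also have "\<dots> = m"
    by (simp add: sum[OF i(1)] flip: sum_distrib_right)
  finally have "\<bar>k\<bar> * m \<le> 1 * m"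
    by simp
  moreover have "0 < m"
    using l le_m[of l] by linarith
  ultimately show ?thesis
    by (simp only: mult_le_cancel_right_pos)
qed

text \<open>At \<open>a\<^sub>0\<close> the two affine functions take opposite values, so their
  moduli agree. On either side of \<open>a\<^sub>0\<close>, one of the two moduli is at least this
  common value.\<close>

lemma minimax_affine_modulus:
  fixes x y :: real
  assumes "x + y < 0" and "x \<le> y" and "y \<le> 1"
  defines "g \<equiv> \<lambda>a. max \<bar>1 - a * (1 - x)\<bar> \<bar>1 - a * (1 - y)\<bar>"
    and "a\<^sub>0 \<equiv> 2 / (2 - x - y)"
  shows "g a\<^sub>0 = (y - x) / (2 - x - y)" and "g a\<^sub>0 \<le> g a"
proof -
  \<comment> \<open>\<open>a\<^sub>0\<close> solves
    \<open>1 - a * (1 - y) = a * (1 - x) - 1\<close>.\<close>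
  have x0: "1 - a\<^sub>0 * (1 - x) = - ((y - x) / (2 - x - y))"
    and y0: "1 - a\<^sub>0 * (1 - y) = (y - x) / (2 - x - y)"
    using assms(1) by (auto simp: a\<^sub>0_def field_simps)
  have "0 \<le> (y - x) / (2 - x - y)"
    using assms(1,2) by simp
  then show eq: "g a\<^sub>0 = (y - x) / (2 - x - y)"
    unfolding g_def x0 y0 by (simp only: abs_minus_cancel abs_of_nonneg max.idem)
  show "g a\<^sub>0 \<le> g a"
  proof (cases "a \<le> a\<^sub>0")
    case True
    \<comment> \<open>To the left of \<open>a\<^sub>0\<close> the \<open>y\<close> term is no
      smaller than at \<open>a\<^sub>0\<close>.\<close>
    then have "a * (1 - y) \<le> a\<^sub>0 * (1 - y)"
      using assms(3) by (intro mult_right_mono) auto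
    then show ?thesis
      using eq y0 unfolding g_def by linarith
  next
    case False
    \<comment> \<open>To the right the \<open>x\<close> term takes over; \<open>x + y < 0\<close>
      and \<open>x \<le> y\<close> give \<open>x < 0\<close>, so \<open>1 - x\<close> is
      positive.\<close>
    then have "a\<^sub>0 * (1 - x) \<le> a * (1 - x)"
      using assms(1,2) by (intro mult_right_mono) auto
    then show ?thesis
      using eq x0 unfolding g_def by linarith
  qed
qed

lemma eig_antimono:
  assumes "diagonalizable W" and "1 \<le> i" and "i \<le> j" and "j \<le> dim_row W"
  shows "eig j W \<le> eig i W"
proof -
  obtain D where D: "diagonal_mat D" and sim: "similar_mat W D"
    using assms(1) unfolding diagonalizable_def by blast
  note dim = dim_similar_mat[OF sim]
  show ?thesis
    unfolding eig_similar_diagonal[OF sim D]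
    using assms(2-4) dim by (intro sorted_rev_nth_mono) (auto simp: diag_mat_def)
qed

theorem proposition6:
  fixes n :: nat and G :: "nat pair_pre_digraph" and W :: "real mat"
  assumes "n \<ge> 2"
    and "network n G"
    and "strongly_connected (with_proj G)"
    and "communication_matrix n G W"
    and "diagonalizable W"
    and "eig n W + eig 2 W < 0"
  defines "\<alpha>_opt \<equiv> 2 / (2 - eig n W - eig 2 W)"
    and "\<gamma>_opt \<equiv> (2 - 2 * eig 2 W) / (2 - eig n W - eig 2 W)"
  shows "is_arg_max (\<lambda>\<alpha>. spectral_gap (modified_matrix \<alpha> W)) (\<lambda>\<alpha>. \<alpha> \<in> {0..1}) \<alpha>_opt
    \<and> spectral_gap (modified_matrix \<alpha>_opt W) = \<gamma>_opt"
proof -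
  define x where "x = eig n W"
  define y where "y = eig 2 W"
  have stoch: "row_stochastic n W"
    using assms(4) unfolding communication_matrix_def by simp
  then have dim: "dim_row W = n"
    unfolding row_stochastic_def by auto
  have bound: "\<bar>x\<bar> \<le> 1" "\<bar>y\<bar> \<le> 1"
    unfolding x_def y_def
    using assms(1,5) dim by (auto intro!: row_stochastic_eigenvalue_bound[OF stoch] eig_is_eigenvalue)
  have le: "x \<le> y"
    unfolding x_def y_def using eig_antimono[OF assms(5), of 2 n] assms(1) dim by simp
  have neg: "x + y < 0"
    unfolding x_def y_def by (rule assms(6))
  \<comment> \<open>The optimal gap is rewritten as 1 minus the common modulus at the crossing
    point.\<close>
  have opt: "\<alpha>_opt = 2 / (2 - x - y)" "\<gamma>_opt = 1 - (y - x) / (2 - x - y)"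
    using neg unfolding \<alpha>_opt_def \<gamma>_opt_def x_def y_def by (auto simp: field_simps)
  \<comment> \<open>The crossing point lies in the admissible interval because
    \<open>x + y < 0\<close> makes the denominator exceed 2.\<close>
  have opt_mem: "\<alpha>_opt \<in> {0..1}"
    using neg unfolding opt by simp
  have gap: "spectral_gap (modified_matrix \<alpha> W) = 1 - max \<bar>1 - \<alpha> * (1 - x)\<bar> \<bar>1 - \<alpha> * (1 - y)\<bar>"
    if "\<alpha> \<in> {0..1}" for \<alpha>
  proof -
    have "dim_row (modified_matrix \<alpha> W) = n"
      using dim by (simp add: modified_matrix_def)
    then show ?thesis
      using that assms(1) dim eig_modified_matrix[OF assms(5), of _ \<alpha>]
      unfolding spectral_gap_def eig_max_def x_def y_def by simp
  qed
  have y1: "y \<le> 1"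
    using bound by simp
  note minimax = minimax_affine_modulus[OF neg le y1, folded opt(1)]
  \<comment> \<open>The minimax bound holds for every real argument; membership in the interval
    serves to express the gap by the two affine functions.\<close>
  have "spectral_gap (modified_matrix \<alpha> W) \<le> spectral_gap (modified_matrix \<alpha>_opt W)"
    if "\<alpha> \<in> {0..1}" for \<alpha>
    using minimax(2)[of \<alpha>] unfolding gap[OF that] gap[OF opt_mem] by simp
  moreover have "spectral_gap (modified_matrix \<alpha>_opt W) = \<gamma>_opt"
    unfolding gap[OF opt_mem] opt(2) minimax(1) ..
  ultimately show ?thesis
    unfolding is_arg_max_def using opt_mem by (auto simp: not_less)
qed

end
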